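(* Let $\mathbf{M}\cong\bigcup_{\mathcal F}M_i$ be a simple non-Hausdorff manifold, presented by a simple adjunction system $\mathcal F$ with finite indexing set $I$. If $V$ is an $H$-submanifold of $\mathbf{M}$ that satisfies the equality $\boldsymbol{\partial}V=\mathsf{Y}^V$, then $V=M_i$ (that is, $V=\phi_i(M_i)$) for some $i\in I$.
   Context: An adjunction system $\mathcal F$ indexed by a set $I$ consists of topological spaces $X_i$, subsets $A_{ij}\subseteq X_i$ (with the subspace topology) and continuous maps $f_{ij}:A_{ij}\to X_j$ such that for all $i,j,k\in I$: (A1) $A_{ii}=X_i$ and $f_{ii}=\mathrm{id}_{X_i}$; (A2) $A_{ji}=f_{ij}(A_{ij})$ and $f_{ij}^{-1}=f_{ji}$ (so $f_{ij}$ is a homeomorphism onto $A_{ji}$); (A3) for each $a\in A_{ij}\cap A_{ik}$ one has $f_{ij}(a)\in A_{jk}$ and $f_{ik}(a)=f_{jk}(f_{ij}(a))$. The adjunction space $\bigcup_{\mathcal F}X_i$ is the quotient (with the quotient topology) of the disjoint union $\bigsqcup_i X_i$ by the equivalence relation $(x,i)\cong(y,j)$ iff $x\in A_{ij}$ and $f_{ij}(x)=y$; the class of $(x,i)$ is $[x,i]$, and $\phi_i:X_i\to\bigcup_{\mathcal F}X_i$ is the canonical map $x\mapsto[x,i]$. All manifolds (Hausdorff or not) are locally Euclidean, second-countable and connected; a non-Hausdorff manifold is such a space that is not Hausdorff. A non-Hausdorff manifold $\mathbf{M}$ is simple if it is homeomorphic to an adjunction space $\bigcup_{\mathcal F}M_i$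 in which: $I$ is finite; every $M_i$ is the same Hausdorff manifold $M$; for all $i\neq j$, $A_{ij}$ is the same connected open subspace $A\subseteq M$, which has connected boundary in $M$; and for all $i\ne j$, $f_{ij}$ is the identity. Such an $\mathcal F$ is called a simple adjunction system. One identifies $M_i$ with the open subspace $\phi_i(M_i)$ of $\mathbf{M}$. $\boldsymbol{\partial}V$ denotes the topological boundary of $V$ in $\mathbf{M}$. For $x,y\in\mathbf{M}$, $x\mathsf{Y}y$ means every open neighbourhood of $x$ intersects every open neighbourhood of $y$. For $V\subseteq\mathbf{M}$, $\mathsf{Y}^V:=\{x\in\mathbf{M} : \exists y\in V,\ y\neq x,\ x\mathsf{Y}y\}$. An $H$-submanifold of $\mathbf{M}$ is a subset that is open, Hausdorff and connected, and is maximal (under inclusion) among subsets with these properties. *)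

theory Defs
  imports "HOL-Analysis.Analysis"
begin

section \<open>Quotient spaces\<close>

definition quotient_topology :: "'a topology \<Rightarrow> ('a \<times> 'a) set \<Rightarrow> 'a set topology" where
  "quotient_topology X r =
     topology (\<lambda>U. U \<subseteq> topspace X // r \<and> openin X {x \<in> topspace X. r `` {x} \<in> U})"

lemma openin_quotient_topology:
  "openin (quotient_topology X r) U \<longleftrightarrow>
     U \<subseteq> topspace X // r \<and> openin X {x \<in> topspace X. r `` {x} \<in> U}"
proof -
  have "istopology (\<lambda>U. U \<subseteq> topspace X // r \<and> openin X {x \<in> topspace X. r `` {x} \<in> U})"
  proof -
    have 1: "{x \<in> topspace X. r `` {x} \<in> S \<inter> T} =
        {x \<in> topspace X. r `` {x} \<in> S} \<inter> {x \<in> topspace X. r `` {x} \<in> T}" for S T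
      by auto
    have 2: "{x \<in> topspace X. r `` {x} \<in> \<Union>K} = (\<Union>S\<in>K. {x \<in> topspace X. r `` {x} \<in> S})" for K
      by auto
    show ?thesis
      unfolding istopology_def 1 2 by blast
  qed
  then show ?thesis
    by (simp add: quotient_topology_def)
qed

lemma topspace_quotient_topology: "topspace (quotient_topology X r) = topspace X // r"
proof
  show "topspace (quotient_topology X r) \<subseteq> topspace X // r"
    using openin_topspace[of "quotient_topology X r"] unfolding openin_quotient_topology ..
  have "{x \<in> topspace X. r `` {x} \<in> topspace X // r} = topspace X"
    by (auto intro: quotientI)
  then have "openin (quotient_topology X r) (topspace X // r)"
    by (simp add: openin_quotient_topology)
  then show "topspace X // r \<subseteq> topspace (quotient_topology X r)"
    by (rule openin_subset)
qed

lemma quotient_map_quotient_topology: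
  "quotient_map X (quotient_topology X r) (\<lambda>x. r `` {x})"
proof -
  have "(\<lambda>x. r `` {x}) ` topspace X = topspace X // r"
    by (auto simp: quotient_def)
  then show ?thesis
    by (simp add: quotient_map_def topspace_quotient_topology openin_quotient_topology)
qed

section \<open>Adjunction spaces\<close>

text \<open>The equation for \<open>f j i\<close> being inverse to \<open>f i j\<close> is only stated on \<^term>\<open>A i j\<close>;
  since it is required for all pairs of indices, the other composite is covered as well.\<close>

definition adjunction_system ::
    "'i set \<Rightarrow> ('i \<Rightarrow> 'a topology) \<Rightarrow> ('i \<Rightarrow> 'i \<Rightarrow> 'a set) \<Rightarrow> ('i \<Rightarrow> 'i \<Rightarrow> 'a \<Rightarrow> 'a) \<Rightarrow> bool" where
  "adjunction_system I X A f \<longleftrightarrow>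
     (\<forall>i\<in>I. \<forall>j\<in>I. A i j \<subseteq> topspace (X i) \<and>
        continuous_map (subtopology (X i) (A i j)) (X j) (f i j)) \<and>
     (\<forall>i\<in>I. A i i = topspace (X i) \<and> (\<forall>x\<in>topspace (X i). f i i x = x)) \<and>
     (\<forall>i\<in>I. \<forall>j\<in>I. A j i = f i j ` A i j \<and> (\<forall>a\<in>A i j. f j i (f i j a) = a)) \<and>
     (\<forall>i\<in>I. \<forall>j\<in>I. \<forall>k\<in>I. \<forall>a\<in>A i j \<inter> A i k.
        f i j a \<in> A j k \<and> f i k a = f j k (f i j a))"

text \<open>The point written \<open>(x, i)\<close> of the disjoint union is the pair \<open>(i, x)\<close> of
  \<^const>\<open>sum_topology\<close>.\<close>

definition gluing_rel ::
    "'i set \<Rightarrow> ('i \<Rightarrow> 'i \<Rightarrow> 'a set) \<Rightarrow> ('i \<Rightarrow> 'i \<Rightarrow> 'a \<Rightarrow> 'a) \<Rightarrow> (('i \<times> 'a) \<times> ('i \<times> 'a)) set" where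
  "gluing_rel I A f = {((i, x), (j, y)) | i x j y. i \<in> I \<and> j \<in> I \<and> x \<in> A i j \<and> f i j x = y}"

definition adjunction_space ::
    "'i set \<Rightarrow> ('i \<Rightarrow> 'a topology) \<Rightarrow> ('i \<Rightarrow> 'i \<Rightarrow> 'a set) \<Rightarrow> ('i \<Rightarrow> 'i \<Rightarrow> 'a \<Rightarrow> 'a) \<Rightarrow>
     ('i \<times> 'a) set topology" where
  "adjunction_space I X A f = quotient_topology (sum_topology X I) (gluing_rel I A f)"

definition canonical_map ::
    "'i set \<Rightarrow> ('i \<Rightarrow> 'i \<Rightarrow> 'a set) \<Rightarrow> ('i \<Rightarrow> 'i \<Rightarrow> 'a \<Rightarrow> 'a) \<Rightarrow> 'i \<Rightarrow> 'a \<Rightarrow> ('i \<times> 'a) set" where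
  "canonical_map I A f i x = gluing_rel I A f `` {(i, x)}"

lemma equiv_gluing_rel:
  assumes "adjunction_system I X A f"
  shows "equiv (topspace (sum_topology X I)) (gluing_rel I A f)"
proof (rule equivI)
  note F = assms[unfolded adjunction_system_def]
  note F1 = F[THEN conjunct1, rule_format]
    and F2 = F[THEN conjunct2, THEN conjunct1, rule_format]
    and F3 = F[THEN conjunct2, THEN conjunct2, THEN conjunct1, rule_format]
    and F4 = F[THEN conjunct2, THEN conjunct2, THEN conjunct2, rule_format]
  have sub: "x \<in> topspace (X i)" if "i \<in> I" "j \<in> I" "x \<in> A i j" for i j x
    using F1[OF that(1,2)] that(3) by (meson subsetD)
  have id: "A i i = topspace (X i)" "x \<in> topspace (X i) \<Longrightarrow> f i i x = x" if "i \<in> I" for i x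
    using F2[OF that] by simp_all
  have inv: "f i j x \<in> A j i" "f j i (f i j x) = x" if "i \<in> I" "j \<in> I" "x \<in> A i j" for i j x
  proof -
    note eq = F3[OF that(1,2), THEN conjunct1] and left_inv = F3[OF that(1,2), THEN conjunct2]
    show "f i j x \<in> A j i"
      by (rule eq[THEN equalityD2, THEN subsetD, OF imageI, OF that(3)])
    show "f j i (f i j x) = x"
      by (rule left_inv[THEN bspec, OF that(3)])
  qed
  have dom: "f i j x \<in> A j k"
    if "i \<in> I" "j \<in> I" "k \<in> I" "x \<in> A i j" "x \<in> A i k" for i j k x
    by (rule F4[OF that(1-3) IntI[OF that(4,5)], THEN conjunct1])
  have cocycle: "f i k x = f j k (f i j x)"
    if "i \<in> I" "j \<in> I" "k \<in> I" "x \<in> A i j" "x \<in> A i k" for i j k x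
    by (rule F4[OF that(1-3) IntI[OF that(4,5)], THEN conjunct2])
  show "gluing_rel I A f \<subseteq> topspace (sum_topology X I) \<times> topspace (sum_topology X I)"
  proof
    fix p assume "p \<in> gluing_rel I A f"
    then obtain i x j where "p = ((i, x), (j, f i j x))" "i \<in> I" "j \<in> I" "x \<in> A i j"
      by (auto simp: gluing_rel_def)
    then show "p \<in> topspace (sum_topology X I) \<times> topspace (sum_topology X I)"
      using sub[of i j x] sub[of j i "f i j x"] inv(1)[of i j x] by simp
  qed
  show "refl_on (topspace (sum_topology X I)) (gluing_rel I A f)"
    by (auto simp: gluing_rel_def refl_on_def id)
  show "sym (gluing_rel I A f)"
    by (auto simp: gluing_rel_def sym_def inv)
  show "trans (gluing_rel I A f)"
  proof (rule transI)
    fix p q r assume "(p, q) \<in> gluing_rel I A f" "(q, r) \<in> gluing_rel I A f"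
    then obtain i x j y k z where
      eqs: "p = (i, x)" "q = (j, y)" "r = (k, z)"
      and I: "i \<in> I" "j \<in> I" "k \<in> I"
      and xy: "x \<in> A i j" "f i j x = y" and yz: "y \<in> A j k" "f j k y = z"
      by (auto simp: gluing_rel_def)
    have y: "y \<in> A j i" "f j i y = x"
      using inv[OF I(1,2) xy(1)] xy(2) by auto
    have "x \<in> A i k" "f i k x = z"
      using dom[OF I(2,1,3) y(1) yz(1)] cocycle[OF I(2,1,3) y(1) yz(1)] y(2) yz(2) by auto
    then show "(p, r) \<in> gluing_rel I A f"
      using eqs I by (auto simp: gluing_rel_def)
  qed
qed

section \<open>Manifolds\<close>

definition locally_Euclidean_space :: "'a topology \<Rightarrow> bool" where
  "locally_Euclidean_space X \<longleftrightarrow>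
     (\<exists>n. \<forall>x\<in>topspace X. \<exists>U W. openin X U \<and> x \<in> U \<and> openin (Euclidean_space n) W \<and>
        subtopology X U homeomorphic_space subtopology (Euclidean_space n) W)"

text \<open>Hausdorffness is not part of the notion of manifold.\<close>

definition manifold :: "'a topology \<Rightarrow> bool" where
  "manifold X \<longleftrightarrow> locally_Euclidean_space X \<and> second_countable X \<and> connected_space X"

definition non_Hausdorff_manifold :: "'a topology \<Rightarrow> bool" where
  "non_Hausdorff_manifold X \<longleftrightarrow> manifold X \<and> \<not> Hausdorff_space X"

definition simple_adjunction_system ::
    "'i set \<Rightarrow> ('i \<Rightarrow> 'a topology) \<Rightarrow> ('i \<Rightarrow> 'i \<Rightarrow> 'a set) \<Rightarrow> ('i \<Rightarrow> 'i \<Rightarrow> 'a \<Rightarrow> 'a) \<Rightarrow> bool" where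
  "simple_adjunction_system I X A f \<longleftrightarrow>
     adjunction_system I X A f \<and> finite I \<and>
     (\<exists>M S. manifold M \<and> Hausdorff_space M \<and> (\<forall>i\<in>I. X i = M) \<and>
        openin M S \<and> connectedin M S \<and> connectedin M (M frontier_of S) \<and>
        (\<forall>i\<in>I. \<forall>j\<in>I. i \<noteq> j \<longrightarrow> A i j = S \<and> (\<forall>x\<in>S. f i j x = x)))"

section \<open>Submanifolds and inseparable points\<close>

definition Y_related :: "'a topology \<Rightarrow> 'a \<Rightarrow> 'a \<Rightarrow> bool" where
  "Y_related X x y \<longleftrightarrow> x \<in> topspace X \<and> y \<in> topspace X \<and>
     (\<forall>U W. openin X U \<and> x \<in> U \<and> openin X W \<and> y \<in> W \<longrightarrow> U \<inter> W \<noteq> {})"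

definition Y_set :: "'a topology \<Rightarrow> 'a set \<Rightarrow> 'a set" where
  "Y_set X V = {x \<in> topspace X. \<exists>y\<in>V. y \<noteq> x \<and> Y_related X x y}"

definition H_submanifold :: "'a topology \<Rightarrow> 'a set \<Rightarrow> bool" where
  "H_submanifold X V \<longleftrightarrow>
     openin X V \<and> Hausdorff_space (subtopology X V) \<and> connectedin X V \<and>
     (\<forall>W. openin X W \<and> Hausdorff_space (subtopology X W) \<and> connectedin X W \<and> V \<subseteq> W \<longrightarrow> W = V)"

end

theory Submission
  imports Defs
begin

text \<open>
  By maximality of \<open>V\<close> it suffices that \<open>V\<close> lies in one copy of \<open>M\<close>. Points that are inseparable
  but distinct lie over the same point of the frontier of the glued part \<open>S\<close>. Hence \<open>\<partial>V = Y\<^sup>V\<close>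
  avoids \<open>S\<close>, and as \<open>S\<close> is connected, it is disjoint from \<open>V\<close> or contained in \<open>V\<close>. In the first
  case \<open>V\<close> lies in the disjoint union of the copies of the exterior of \<open>S\<close>, hence in one of them.
  In the second case every frontier point of \<open>S\<close> has all its copies in the closure of \<open>V\<close>, so
  exactly one of them lies in \<open>V\<close>; by connectedness of the frontier this copy has the same index
  \<open>j\<close> throughout. So the part of \<open>V\<close> outside the \<open>j\<close>-th copy of \<open>M\<close> lies in the copies of the
  exterior of \<open>S\<close> and is open, and therefore empty.
\<close>

text \<open>If \<open>C\<close> meets \<open>U i\<close>, then \<open>U i\<close> and the union of
  the other members would separate \<open>C\<close> unless \<open>C\<close> misses that union.
  Disjointness is asked only inside \<open>C\<close>, so the family may overlap elsewhere.\<close>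

lemma connectedin_subset_of_disjoint_family:
  assumes "connectedin X C" and "I \<noteq> {}" and "\<And>i. i \<in> I \<Longrightarrow> openin X (U i)"
    and "C \<subseteq> (\<Union>i\<in>I. U i)"
    and "\<And>i j. \<lbrakk>i \<in> I; j \<in> I; i \<noteq> j\<rbrakk> \<Longrightarrow> U i \<inter> U j \<inter> C = {}"
  shows "\<exists>i\<in>I. C \<subseteq> U i"
proof (cases "C = {}")
  case False
  then obtain x i where x: "x \<in> C" "i \<in> I" "x \<in> U i"
    using assms(4) by blast
  let ?W = "\<Union>j\<in>I - {i}. U j"
  have "openin X ?W"
    using assms(3) by blast
  moreover have "C \<subseteq> U i \<union> ?W"
    using assms(4) by blast
  moreover have "U i \<inter> ?W \<inter> C = {}"
    using assms(5) x(2) by blast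
  ultimately have "U i \<inter> C = {} \<or> ?W \<inter> C = {}"
    using assms(1,3) x(2) unfolding connectedin by blast
  then have "C \<subseteq> U i"
    using x \<open>C \<subseteq> U i \<union> ?W\<close> by blast
  then show ?thesis
    using x(2) by blast
qed (use assms(2) in auto)

section \<open>Canonical maps of an adjunction space\<close>

lemma canonical_map_eq_iff:
  assumes "adjunction_system I X A f" and "i \<in> I" and "x \<in> topspace (X i)"
    and "j \<in> I" and "y \<in> topspace (X j)"
  shows "canonical_map I A f i x = canonical_map I A f j y \<longleftrightarrow> x \<in> A i j \<and> f i j x = y"
proof -
  have "canonical_map I A f i x = canonical_map I A f j y \<longleftrightarrow> ((i, x), (j, y)) \<in> gluing_rel I A f"
    unfolding canonical_map_def
    using assms by (intro eq_equiv_class_iff[OF equiv_gluing_rel[OF assms(1)]]) auto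
  then show ?thesis
    using assms by (auto simp: gluing_rel_def)
qed

lemma topspace_adjunction_space:
  "topspace (adjunction_space I X A f) = (\<Union>i\<in>I. canonical_map I A f i ` topspace (X i))"
  unfolding adjunction_space_def topspace_quotient_topology quotient_def canonical_map_def
  by fastforce

lemma continuous_map_canonical_map:
  assumes "i \<in> I"
  shows "continuous_map (X i) (adjunction_space I X A f) (canonical_map I A f i)"
proof -
  have "canonical_map I A f i = (\<lambda>p. gluing_rel I A f `` {p}) \<circ> (\<lambda>x. (i, x))"
    by (auto simp: canonical_map_def)
  moreover have "continuous_map (X i) (sum_topology X I) (\<lambda>x. (i, x))"
    using assms by (rule continuous_map_component_injection)
  ultimately show ?thesis
    unfolding adjunction_space_def
    using quotient_map_quotient_topology[THEN quotient_imp_continuous_map]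
    by (metis continuous_map_compose)
qed

text \<open>Openness in the quotient is tested on each summand \<open>X j\<close>. There the image
  of \<open>U\<close> pulls back to the preimage of \<open>U\<close> under \<open>f j i\<close>,
  which is open in \<open>A j i\<close> by continuity, hence open in \<open>X j\<close>.\<close>

lemma open_map_canonical_map:
  assumes sys: "adjunction_system I X A f"
    and op: "\<And>i j. \<lbrakk>i \<in> I; j \<in> I\<rbrakk> \<Longrightarrow> openin (X i) (A i j)"
    and i: "i \<in> I"
  shows "open_map (X i) (adjunction_space I X A f) (canonical_map I A f i)"
  unfolding open_map_def
proof (intro allI impI)
  fix U assume U: "openin (X i) U"
  let ?\<phi> = "canonical_map I A f"
  have "openin (X j) {y \<in> topspace (X j). ?\<phi> j y \<in> ?\<phi> i ` U}" if j: "j \<in> I" for j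
  proof -
    have cont: "continuous_map (subtopology (X j) (A j i)) (X i) (f j i)"
      using sys[unfolded adjunction_system_def, THEN conjunct1] i j by blast
    have A: "A j i \<subseteq> topspace (X j)"
      using op[OF j i] openin_subset by blast
    have "?\<phi> j y \<in> ?\<phi> i ` U \<longleftrightarrow> y \<in> A j i \<and> f j i y \<in> U" if y: "y \<in> topspace (X j)" for y
    proof -
      have "?\<phi> j y = ?\<phi> i u \<longleftrightarrow> y \<in> A j i \<and> f j i y = u" if "u \<in> U" for u
        using canonical_map_eq_iff[OF sys j y i] U that openin_subset by blast
      then show ?thesis
        by (auto simp: image_iff)
    qed
    then have eq: "{y \<in> topspace (X j). ?\<phi> j y \<in> ?\<phi> i ` U}
        = {y \<in> topspace (subtopology (X j) (A j i)). f j i y \<in> U}"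
      using A by auto
    show ?thesis
      unfolding eq
      by (rule openin_trans_full[OF openin_continuous_map_preimage[OF cont U] op[OF j i]])
  qed
  moreover have "?\<phi> i ` U \<subseteq> topspace (sum_topology X I) // gluing_rel I A f"
    using openin_subset[OF U] i by (auto simp: canonical_map_def intro!: quotientI)
  ultimately show "openin (adjunction_space I X A f) (?\<phi> i ` U)"
    by (simp add: adjunction_space_def openin_quotient_topology openin_sum_topology
        canonical_map_def subset_iff)
qed

section \<open>Inseparable points and frontiers in an arbitrary space\<close>

lemma Hausdorff_open_imp_not_Y_related:
  assumes "openin X V" and "Hausdorff_space (subtopology X V)"
    and "x \<in> V" and "y \<in> V" and "x \<noteq> y"
  shows "\<not> Y_related X x y"
proof -
  have "x \<in> topspace (subtopology X V)" "y \<in> topspace (subtopology X V)"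
    using assms(1,3,4) openin_subset by auto
  then obtain U W where "openin (subtopology X V) U" "openin (subtopology X V) W"
    "x \<in> U" "y \<in> W" "disjnt U W"
    using assms(2,5) unfolding Hausdorff_space_def by metis
  then show ?thesis
    using assms(1) openin_trans_full unfolding Y_related_def disjnt_def by metis
qed

lemma connectedin_subset_or_disjoint_open:
  assumes "connectedin X C" and "openin X V" and "C \<inter> X frontier_of V = {}"
  shows "C \<subseteq> V \<or> C \<inter> V = {}"
  using connectedin_Int_frontier_of[OF assms(1), of V] assms(3) by blast

text \<open>This replaces equivalence classes by maps: \<open>N\<close> is covered by open copies of
  \<open>M\<close> that are identified exactly along \<open>S\<close>. In
  \<open>\<phi>_eq_iff\<close> the case \<open>i = j\<close> is injectivity, the case
  \<open>i \<noteq> j\<close> is the gluing.\<close>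

locale glued_copies =
  fixes M :: "'a topology" and S :: "'a set" and N :: "'b topology"
    and I :: "'i set" and \<phi> :: "'i \<Rightarrow> 'a \<Rightarrow> 'b"
  assumes Hausdorff_M: "Hausdorff_space M"
    and connected_M: "connected_space M"
    and open_S: "openin M S"
    and connected_S: "connectedin M S"
    and connected_frontier_S: "connectedin M (M frontier_of S)"
    and continuous_\<phi>: "i \<in> I \<Longrightarrow> continuous_map M N (\<phi> i)"
    and open_\<phi>: "i \<in> I \<Longrightarrow> open_map M N (\<phi> i)"
    and topspace_N: "topspace N = (\<Union>i\<in>I. \<phi> i ` topspace M)"
    and \<phi>_eq_iff: "\<lbrakk>i \<in> I; j \<in> I; x \<in> topspace M; y \<in> topspace M\<rbrakk> \<Longrightarrow>
      \<phi> i x = \<phi> j y \<longleftrightarrow> x = y \<and> (i = j \<or> x \<in> S)"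
begin

text \<open>The exterior of \<open>S\<close>. Its copies are open and pairwise disjoint, so a
  connected set covered by them lies in one of them.\<close>

abbreviation E :: "'a set" where
  "E \<equiv> topspace M - M closure_of S"

lemma S_subset: "S \<subseteq> topspace M"
  using open_S by (rule openin_subset)

lemma openin_E: "openin M E"
  by (simp add: openin_diff)

lemma frontier_S: "M frontier_of S = M closure_of S - S"
  using open_S by (simp add: frontier_of_def interior_of_openin)

lemma topspace_M: "topspace M = S \<union> M frontier_of S \<union> E"
  using closure_of_subset[OF S_subset] closure_of_subset_topspace[of M S] frontier_S by auto

lemma S_Int_E: "S \<inter> E = {}"
  using closure_of_subset[OF S_subset] by auto

lemma openin_image: "i \<in> I \<Longrightarrow> openin M U \<Longrightarrow> openin N (\<phi> i ` U)"
  using open_\<phi> by (auto simp: open_map_def)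

lemma openin_preimage: "i \<in> I \<Longrightarrow> openin N U \<Longrightarrow> openin M {x \<in> topspace M. \<phi> i x \<in> U}"
  using continuous_\<phi> by (rule openin_continuous_map_preimage)

section \<open>Overlaps of the copies and inseparable points\<close>

lemma image_E_disjoint:
  assumes "i \<in> I" and "j \<in> I" and "i \<noteq> j"
  shows "\<phi> i ` E \<inter> \<phi> j ` topspace M = {}"
  using \<phi>_eq_iff[OF assms(1,2)] assms(3) S_Int_E by auto

lemma image_S_eq:
  assumes "i \<in> I" and "j \<in> I"
  shows "\<phi> i ` S = \<phi> j ` S"
  using \<phi>_eq_iff[OF assms] S_subset by (intro image_cong) auto

text \<open>Gluing identifies only equal points of \<open>M\<close>, so disjoint neighbourhoods in
  the Hausdorff space \<open>M\<close> keep disjoint images, even in different copies.\<close>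

lemma Y_related_imp_eq:
  assumes "i \<in> I" and "j \<in> I" and "x \<in> topspace M" and "y \<in> topspace M"
    and Y: "Y_related N (\<phi> i x) (\<phi> j y)"
  shows "x = y"
proof (rule ccontr)
  assume "x \<noteq> y"
  then obtain U W where UW: "openin M U" "openin M W" "x \<in> U" "y \<in> W" "disjnt U W"
    using Hausdorff_M assms(3,4) unfolding Hausdorff_space_def by metis
  moreover have "\<phi> i ` U \<inter> \<phi> j ` W = {}"
    using \<phi>_eq_iff[OF assms(1,2)] UW(5) openin_subset[OF UW(1)] openin_subset[OF UW(2)]
    by (fastforce simp: disjnt_iff)
  moreover have "openin N (\<phi> i ` U)" "openin N (\<phi> j ` W)"
    using UW assms(1,2) openin_image by auto
  ultimately show False
    using Y unfolding Y_related_def by blast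
qed

text \<open>Neighbourhoods of both copies pull back to neighbourhoods of \<open>x\<close> in
  \<open>M\<close>. Their intersection meets \<open>S\<close>, where the two maps agree.\<close>

lemma Y_related_frontier:
  assumes i: "i \<in> I" and j: "j \<in> I" and x: "x \<in> M frontier_of S"
  shows "Y_related N (\<phi> i x) (\<phi> j x)"
  unfolding Y_related_def
proof (intro conjI allI impI)
  have x': "x \<in> topspace M" "x \<in> M closure_of S"
    using x topspace_M frontier_S by auto
  then show "\<phi> i x \<in> topspace N" "\<phi> j x \<in> topspace N"
    using i j topspace_N by auto
  fix U W assume UW: "openin N U \<and> \<phi> i x \<in> U \<and> openin N W \<and> \<phi> j x \<in> W"
  let ?T = "{z \<in> topspace M. \<phi> i z \<in> U} \<inter> {z \<in> topspace M. \<phi> j z \<in> W}"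
  have "openin M ?T" "x \<in> ?T"
    using UW i j x' openin_preimage by (auto intro!: openin_Int)
  then have "?T \<inter> S \<noteq> {}"
    using openin_Int_closure_of_eq_empty[of M ?T S] x'(2) by blast
  then obtain s where "s \<in> S" "s \<in> ?T"
    by blast
  moreover have "\<phi> i s = \<phi> j s"
    using \<open>s \<in> S\<close> \<open>s \<in> ?T\<close> \<phi>_eq_iff[OF i j] by auto
  ultimately show "U \<inter> W \<noteq> {}"
    by auto
qed

text \<open>The partner of \<open>\<phi> i x\<close> in \<open>V\<close> is another copy of the same
  \<open>x\<close>. Being a different point of \<open>N\<close>, it forces \<open>x\<close> to lie
  outside \<open>S\<close>.\<close>

lemma Y_setD:
  assumes i: "i \<in> I" and x: "x \<in> topspace M" and Y: "\<phi> i x \<in> Y_set N V"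
  obtains j where "j \<in> I" "\<phi> j x \<in> V" "x \<notin> S"
proof -
  obtain v where v: "v \<in> V" "v \<noteq> \<phi> i x" "Y_related N (\<phi> i x) v"
    using Y unfolding Y_set_def by blast
  then have "v \<in> topspace N"
    by (simp add: Y_related_def)
  then obtain j y where j: "j \<in> I" "y \<in> topspace M" "v = \<phi> j y"
    using topspace_N by auto
  then have "y = x"
    using Y_related_imp_eq[OF i j(1) x j(2)] v(3) by simp
  then show ?thesis
    using that j v \<phi>_eq_iff[OF i j(1) x x] by auto
qed

lemma Y_set_disjoint_S:
  assumes "i \<in> I"
  shows "\<phi> i ` S \<inter> Y_set N V = {}"
  using Y_setD[OF assms] S_subset by blast

section \<open>Confining an H-submanifold to one copy\<close>

lemma Hausdorff_image:
  assumes "i \<in> I"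
  shows "Hausdorff_space (subtopology N (\<phi> i ` topspace M))"
proof -
  have "embedding_map M N (\<phi> i)"
    using assms continuous_\<phi> open_\<phi> \<phi>_eq_iff[OF assms assms]
    by (intro injective_open_imp_embedding_map) (auto simp: inj_on_def)
  then show ?thesis
    using Hausdorff_M homeomorphic_Hausdorff_space homeomorphic_map_imp_homeomorphic_space
    unfolding embedding_map_def by blast
qed

text \<open>The copy is itself open, Hausdorff and connected, so the maximality of \<open>V\<close>
  applies to it.\<close>

lemma H_submanifold_eq_copy:
  assumes i: "i \<in> I" and H: "H_submanifold N V" and sub: "V \<subseteq> \<phi> i ` topspace M"
  shows "V = \<phi> i ` topspace M"
proof -
  have "connectedin N (\<phi> i ` topspace M)"
    using connected_M continuous_\<phi>[OF i] connectedin_continuous_map_image connectedin_topspace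
    by metis
  moreover have "openin N (\<phi> i ` topspace M)"
    using i by (simp add: openin_image)
  ultimately show ?thesis
    using H sub Hausdorff_image[OF i] unfolding H_submanifold_def by blast
qed

lemma connected_disjoint_S_subset_copy:
  assumes "I \<noteq> {}" and V: "openin N V" "connectedin N V"
    and disj: "\<And>i. i \<in> I \<Longrightarrow> \<phi> i ` S \<inter> V = {}"
  shows "\<exists>i\<in>I. V \<subseteq> \<phi> i ` topspace M"
proof -
  have "V \<subseteq> (\<Union>i\<in>I. \<phi> i ` E)"
  proof
    fix v assume v: "v \<in> V"
    then obtain i x where x: "i \<in> I" "x \<in> topspace M" "v = \<phi> i x"
      using openin_subset[OF V(1)] topspace_N by auto
    let ?T = "{z \<in> topspace M. \<phi> i z \<in> V}"
    have "openin M ?T" "x \<in> ?T" "S \<inter> ?T = {}"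
      using openin_preimage[OF x(1) V(1)] x v disj by auto
    \<comment> \<open>An open set that misses \<open>S\<close> also misses its closure.\<close>
    then have "x \<in> E"
      using x(2) openin_Int_closure_of_eq_empty[of M ?T S] by (simp only: Int_commute) blast
    then show "v \<in> (\<Union>i\<in>I. \<phi> i ` E)"
      using x by blast
  qed
  moreover have "\<phi> i ` E \<inter> \<phi> j ` E = {}" if "i \<in> I" "j \<in> I" "i \<noteq> j" for i j
    using image_E_disjoint[OF that] by blast
  ultimately obtain i where "i \<in> I" "V \<subseteq> \<phi> i ` E"
    using connectedin_subset_of_disjoint_family[OF V(2) assms(1), of "\<lambda>i. \<phi> i ` E"]
      openin_image openin_E by blast
  then show ?thesis
    by blast
qed

lemma frontier_copies_disjoint:
  assumes "I \<noteq> {}" and V: "openin N V" "Hausdorff_space (subtopology N V)"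
    and fr: "N frontier_of V \<subseteq> Y_set N V"
    and S: "\<And>i. i \<in> I \<Longrightarrow> \<phi> i ` S \<subseteq> V"
  shows "\<exists>j\<in>I. \<forall>i\<in>I. i \<noteq> j \<longrightarrow> \<phi> i ` (M frontier_of S) \<inter> V = {}"
proof -
  let ?U = "\<lambda>i. {x \<in> topspace M. \<phi> i x \<in> V}"
  \<comment> \<open>Copies of a frontier point with different indices are distinct but inseparable,
    so a Hausdorff open set contains at most one.\<close>
  have unique: "i = j"
    if "x \<in> M frontier_of S" "i \<in> I" "j \<in> I" "\<phi> i x \<in> V" "\<phi> j x \<in> V" for i j x
  proof (rule ccontr)
    assume "i \<noteq> j"
    have "x \<in> topspace M" "x \<notin> S"
      using that(1) topspace_M frontier_S by auto
    then have "\<phi> i x \<noteq> \<phi> j x"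
      using \<phi>_eq_iff that(2,3) \<open>i \<noteq> j\<close> by simp
    then show False
      using Hausdorff_open_imp_not_Y_related[OF V that(4,5)] Y_related_frontier that(1-3) by blast
  qed
  \<comment> \<open>Any copy of \<open>x\<close> lies in the closure of \<open>V\<close>. If it is
    not in \<open>V\<close>, it is in the frontier, hence in \<open>Y_set N V\<close>, and its
    partner is a copy of \<open>x\<close> inside \<open>V\<close>.\<close>
  have "M frontier_of S \<subseteq> (\<Union>i\<in>I. ?U i)"
  proof
    fix x assume x: "x \<in> M frontier_of S"
    then have x': "x \<in> topspace M" "x \<in> M closure_of S"
      using topspace_M frontier_S by auto
    obtain i where i: "i \<in> I"
      using assms(1) by blast
    have "\<phi> i x \<in> N closure_of (\<phi> i ` S)"
      using continuous_map_image_closure_subset[OF continuous_\<phi>[OF i], of S] x'(2) by blast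
    then have "\<phi> i x \<in> N closure_of V"
      using closure_of_mono[OF S[OF i]] by blast
    then have "\<phi> i x \<in> V \<or> \<phi> i x \<in> Y_set N V"
      using fr V(1) by (auto simp: frontier_of_def interior_of_openin)
    then show "x \<in> (\<Union>i\<in>I. ?U i)"
      using Y_setD[OF i x'(1)] i x'(1) by blast
  qed
  \<comment> \<open>Each \<open>?U i\<close> contains \<open>S\<close>, so disjointness can be
    expected only on the frontier.\<close>
  moreover have "?U i \<inter> ?U j \<inter> M frontier_of S = {}" if "i \<in> I" "j \<in> I" "i \<noteq> j" for i j
    using unique that by blast
  ultimately obtain j where j: "j \<in> I" "M frontier_of S \<subseteq> ?U j"
    using connectedin_subset_of_disjoint_family[OF connected_frontier_S assms(1), of ?U]
      openin_preimage[OF _ V(1)] by blast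
  have "\<phi> i x \<notin> V" if "i \<in> I" "i \<noteq> j" "x \<in> M frontier_of S" for i x
    using unique[OF that(3,1) j(1)] that(2,3) j(2) by auto
  with j(1) show ?thesis
    by (intro bexI[of _ j]) auto
qed

lemma connected_superset_S_subset_copy:
  assumes "I \<noteq> {}" and "S \<noteq> {}"
    and V: "openin N V" "Hausdorff_space (subtopology N V)" "connectedin N V"
    and fr: "N frontier_of V \<subseteq> Y_set N V"
    and S: "\<And>i. i \<in> I \<Longrightarrow> \<phi> i ` S \<subseteq> V"
  shows "\<exists>i\<in>I. V \<subseteq> \<phi> i ` topspace M"
proof -
  obtain j where j: "j \<in> I"
    and frontier: "\<And>i. \<lbrakk>i \<in> I; i \<noteq> j\<rbrakk> \<Longrightarrow> \<phi> i ` (M frontier_of S) \<inter> V = {}"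
    using frontier_copies_disjoint[OF assms(1) V(1,2) fr S] by blast
  let ?C = "\<phi> j ` topspace M" and ?W = "\<Union>i\<in>I - {j}. \<phi> i ` E"
  have "V \<subseteq> ?C \<union> ?W"
  proof
    fix v assume v: "v \<in> V"
    then obtain i x where x: "i \<in> I" "x \<in> topspace M" "v = \<phi> i x"
      using openin_subset[OF V(1)] topspace_N by auto
    \<comment> \<open>A point of \<open>S\<close> also lies in the \<open>j\<close>-th copy, and the
      choice of \<open>j\<close> rules out frontier points with another index. Only exterior points
      remain for \<open>?W\<close>.\<close>
    consider "i = j" | "x \<in> S" | "i \<noteq> j" "x \<in> M frontier_of S" | "i \<noteq> j" "x \<in> E"
      using x(2) topspace_M by blast
    then show "v \<in> ?C \<union> ?W"
    proof cases
      case 2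
      then show ?thesis
        using x image_S_eq[OF x(1) j] S_subset by blast
    next
      case 3
      then show ?thesis
        using x(1,3) v frontier by blast
    qed (use x in blast)+
  qed
  moreover have "?C \<inter> ?W \<inter> V = {}"
    using image_E_disjoint j by blast
  moreover have "openin N ?C" "openin N ?W"
    using openin_image openin_E j by auto
  ultimately have disj: "?C \<inter> V = {} \<or> ?W \<inter> V = {}"
    using V(3) unfolding connectedin by blast
  \<comment> \<open>A point of \<open>S\<close> decides which side of the separation is
    empty.\<close>
  have "?C \<inter> V \<noteq> {}"
    using image_mono[OF S_subset, of "\<phi> j"] S[OF j] assms(2) by auto
  with disj have "?W \<inter> V = {}"
    by argo
  with \<open>V \<subseteq> ?C \<union> ?W\<close> have "V \<subseteq> ?C"
    by blast
  with j show ?thesis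
    by (rule bexI[rotated])
qed

theorem H_submanifold_frontier_Y_set:
  assumes "I \<noteq> {}" and H: "H_submanifold N V" and fr: "N frontier_of V \<subseteq> Y_set N V"
  shows "\<exists>i\<in>I. V = \<phi> i ` topspace M"
proof -
  have V: "openin N V" "Hausdorff_space (subtopology N V)" "connectedin N V"
    using H by (auto simp: H_submanifold_def)
  obtain k where k: "k \<in> I"
    using assms(1) by blast
  have eq: "\<phi> i ` S = \<phi> k ` S" if "i \<in> I" for i
    using that k by (rule image_S_eq)
  have "connectedin N (\<phi> k ` S)"
    using continuous_\<phi>[OF k] connected_S by (rule connectedin_continuous_map_image)
  \<comment> \<open>The frontier of \<open>V\<close> lies in \<open>Y_set N V\<close>, which misses
    the copy of \<open>S\<close>. This connected copy therefore cannot cross it. An empty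
    \<open>S\<close> falls under the first case.\<close>
  then consider "\<phi> k ` S \<inter> V = {}" | "\<phi> k ` S \<subseteq> V" "S \<noteq> {}"
    using connectedin_subset_or_disjoint_open[OF _ V(1)] Y_set_disjoint_S[OF k, of V] fr by blast
  then have "\<exists>i\<in>I. V \<subseteq> \<phi> i ` topspace M"
  proof cases
    case 1
    then show ?thesis
      using connected_disjoint_S_subset_copy[OF assms(1) V(1,3)] eq by blast
  next
    case 2
    then show ?thesis
      using connected_superset_S_subset_copy[OF assms(1) _ V fr] eq by blast
  qed
  then show ?thesis
    using H_submanifold_eq_copy[OF _ H] by blast
qed

end

text \<open>Composing with \<open>h\<close> absorbs the homeomorphism into the copy maps, so the
  abstract result applies to \<open>N\<close> directly.\<close>

lemma glued_copies_adjunction_space: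
  assumes sys: "adjunction_system I X A f"
    and M: "Hausdorff_space M" "connected_space M" and X: "\<And>i. i \<in> I \<Longrightarrow> X i = M"
    and S: "openin M S" "connectedin M S" "connectedin M (M frontier_of S)"
    and A: "\<And>i j. \<lbrakk>i \<in> I; j \<in> I; i \<noteq> j\<rbrakk> \<Longrightarrow> A i j = S \<and> (\<forall>x\<in>S. f i j x = x)"
    and h: "homeomorphic_map (adjunction_space I X A f) N h"
  shows "glued_copies M S N I (\<lambda>i. h \<circ> canonical_map I A f i)"
proof
  let ?\<phi> = "canonical_map I A f" and ?Q = "adjunction_space I X A f"
  have diag: "A i i = topspace M" "x \<in> topspace M \<Longrightarrow> f i i x = x" if "i \<in> I" for i x
    using sys that X by (auto simp: adjunction_system_def)
  have open_A: "openin (X i) (A i j)" if "i \<in> I" "j \<in> I" for i j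
    using A[OF that] diag(1)[OF that(1)] X[OF that(1)] S(1) by (cases "i = j") auto
  show "continuous_map M N (h \<circ> ?\<phi> i)" if "i \<in> I" for i
    using continuous_map_compose[OF continuous_map_canonical_map[OF that, of X A f]
        homeomorphic_imp_continuous_map[OF h]] X[OF that] by simp
  show "open_map M N (h \<circ> ?\<phi> i)" if "i \<in> I" for i
    using open_map_compose[OF open_map_canonical_map[OF sys open_A that]
        homeomorphic_imp_open_map[OF h]] X[OF that] by simp
  have "topspace N = h ` topspace ?Q"
    using homeomorphic_imp_surjective_map[OF h] by simp
  then show "topspace N = (\<Union>i\<in>I. (h \<circ> ?\<phi> i) ` topspace M)"
    using X by (simp add: topspace_adjunction_space image_UN image_comp)
  show "(h \<circ> ?\<phi> i) x = (h \<circ> ?\<phi> j) y \<longleftrightarrow> x = y \<and> (i = j \<or> x \<in> S)"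
    if ij: "i \<in> I" "j \<in> I" and xy: "x \<in> topspace M" "y \<in> topspace M" for i j x y
  proof -
    have "?\<phi> i x \<in> topspace ?Q" "?\<phi> j y \<in> topspace ?Q"
      using ij xy X by (auto simp: topspace_adjunction_space)
    then have "(h \<circ> ?\<phi> i) x = (h \<circ> ?\<phi> j) y \<longleftrightarrow> ?\<phi> i x = ?\<phi> j y"
      using homeomorphic_imp_injective_map[OF h] by (simp add: inj_on_eq_iff)
    also have "\<dots> \<longleftrightarrow> x \<in> A i j \<and> f i j x = y"
      using canonical_map_eq_iff[OF sys ij(1) _ ij(2)] xy X ij by simp
    \<comment> \<open>All gluing maps are identities: on the whole of \<open>M\<close> along the
      diagonal, on \<open>S\<close> off it.\<close>
    also have "\<dots> \<longleftrightarrow> x = y \<and> (i = j \<or> x \<in> S)"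
      using A[OF ij] diag[OF ij(1)] xy by (cases "i = j") auto
    finally show ?thesis .
  qed
qed (use M S in auto)

theorem theorem4p6:
  fixes N :: "'b topology"
    and I :: "'i set"
    and X :: "'i \<Rightarrow> 'a topology"
    and A :: "'i \<Rightarrow> 'i \<Rightarrow> 'a set"
    and f :: "'i \<Rightarrow> 'i \<Rightarrow> 'a \<Rightarrow> 'a"
    and h :: "('i \<times> 'a) set \<Rightarrow> 'b"
    and V :: "'b set"
  assumes "non_Hausdorff_manifold N"
    and "simple_adjunction_system I X A f"
    and "homeomorphic_map (adjunction_space I X A f) N h"
    and "H_submanifold N V"
    and "N frontier_of V = Y_set N V"
  shows "\<exists>i\<in>I. V = h ` canonical_map I A f i ` topspace (X i)"
proof -
  obtain M S where sys: "adjunction_system I X A f"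
    and M: "manifold M" "Hausdorff_space M" and X: "\<forall>i\<in>I. X i = M"
    and S: "openin M S" "connectedin M S" "connectedin M (M frontier_of S)"
    and A: "\<forall>i\<in>I. \<forall>j\<in>I. i \<noteq> j \<longrightarrow> A i j = S \<and> (\<forall>x\<in>S. f i j x = x)"
    using assms(2) unfolding simple_adjunction_system_def by (elim conjE exE)
  have "connected_space M"
    using M(1) by (simp add: manifold_def)
  interpret glued_copies M S N I "\<lambda>i. h \<circ> canonical_map I A f i"
    by (rule glued_copies_adjunction_space[OF sys M(2) \<open>connected_space M\<close> _ S _ assms(3)])
      (use X A in auto)
  \<comment> \<open>The empty space is Hausdorff, so a non-Hausdorff \<open>N\<close> has a point,
    and some index exists.\<close>
  have "topspace N \<noteq> {}"
    using assms(1) by (auto simp: non_Hausdorff_manifold_def Hausdorff_space_def)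
  then have "I \<noteq> {}"
    using topspace_N by auto
  then obtain i where "i \<in> I" "V = (h \<circ> canonical_map I A f i) ` topspace M"
    using H_submanifold_frontier_Y_set[OF _ assms(4)] assms(5) by blast
  then show ?thesis
    using X by (auto simp: image_comp)
qed

end
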